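(* In normed planes, a hyperbola defined by its foci is always a hyperbola defined by its leading circle and a focus. The converse statement is also true: a hyperbola defined by its leading circle and a focus is always a hyperbola defined by its foci. In general, the definition of hyperbolas by a leading line and a focus yields a different class of curves.
   Context: A normed plane $X$ is the real affine plane (with origin $\mathbf 0$) equipped with a norm $\|\cdot\|$; its unit ball (unit disk) is $K=\{\mathbf x\in X:\|\mathbf x\|\le 1\}$. Hyperbola defined by its foci $\mathbf x$ and $\mathbf y$: for two points $\mathbf x,\mathbf y\in X$ and a distance $2a>0$, the set $H(\mathbf x,\mathbf y,a)=\{\mathbf z\in X:\big|\,\|\mathbf z-\mathbf x\|-\|\mathbf y-\mathbf z\|\,\big|=2a\}$. Hyperbola defined by its leading circle and its focus $\mathbf x$: let $L=(2a)\cdot K$ be a homothetic copy of the unit disk $K$ and let $\mathbf x\in X$ be an arbitrary point exterior to $L$; the hyperbola is the locus of points $\mathbf z\in X$ for which there is a positive $\varepsilon$ such that $\mathbf z+\varepsilon K$ touches $L$ and contains $\mathbf x$ on its boundary. Two disks touch if their boundaries have a common point and either their interiors are disjoint or one of the disks contains the other. Hyperbola defined by its leading line and its focus $\mathbf x$: let $l$ be a straight line, $\mathbf x$ a point, and $\gamma=\frac{a}{c}$ a (positive) ratio less than $1$; the hyperbola is the locus of points $\mathbf z\in X$ for which there is a positive $\varepsilon$ such that the boundary of the disk $\mathbf z+\varepsilon K$ contains $\mathbf x$ and the disk $\mathbf z+\gamma(\varepsilon K)$ touches the line $l$ (that is, the disk meets $l$ but its interior does not).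
   Formalization: A hyperbola defined by its foci x, y is taken with 2a < ‖x−y‖; for 2a > ‖x−y‖ the set is empty, and for 2a = ‖x−y‖ it degenerates (two rays in the Euclidean plane), so it is never a hyperbola defined by a leading circle and a focus. *)

theory Defs
  imports "HOL-Analysis.Analysis"
begin

text \<open>
  A normed plane is the vector space \<^typ>\<open>real^2\<close> with an arbitrary norm \<open>N\<close>, kept separate from
  the Euclidean norm of the type. Interiors and boundaries are taken in the standard topology
  of \<^typ>\<open>real^2\<close>, which coincides with the topology of every norm on the plane.
\<close>

definition plane_norm :: "(real^2 \<Rightarrow> real) \<Rightarrow> bool" where
  "plane_norm N \<longleftrightarrow>
     (\<forall>x. N x = 0 \<longleftrightarrow> x = 0) \<and>
     (\<forall>t x. N (t *\<^sub>R x) = \<bar>t\<bar> * N x) \<and>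
     (\<forall>x y. N (x + y) \<le> N x + N y)"

definition unit_disk :: "(real^2 \<Rightarrow> real) \<Rightarrow> (real^2) set" where
  "unit_disk N = {x. N x \<le> 1}"

definition disk :: "(real^2 \<Rightarrow> real) \<Rightarrow> real^2 \<Rightarrow> real \<Rightarrow> (real^2) set" where
  "disk N c r = (\<lambda>v. c + r *\<^sub>R v) ` unit_disk N"

definition disks_touch :: "(real^2) set \<Rightarrow> (real^2) set \<Rightarrow> bool" where
  "disks_touch D E \<longleftrightarrow>
     frontier D \<inter> frontier E \<noteq> {} \<and>
     (interior D \<inter> interior E = {} \<or> D \<subseteq> E \<or> E \<subseteq> D)"

definition straight_line :: "(real^2) set \<Rightarrow> bool" where
  "straight_line l \<longleftrightarrow> affine l \<and> aff_dim l = 1"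

definition disk_touches_line :: "(real^2) set \<Rightarrow> (real^2) set \<Rightarrow> bool" where
  "disk_touches_line D l \<longleftrightarrow> D \<inter> l \<noteq> {} \<and> interior D \<inter> l = {}"

definition foci_hyperbola ::
  "(real^2 \<Rightarrow> real) \<Rightarrow> real^2 \<Rightarrow> real^2 \<Rightarrow> real \<Rightarrow> (real^2) set" where
  "foci_hyperbola N x y a = {z. \<bar>N (z - x) - N (y - z)\<bar> = 2 * a}"

definition leading_circle_hyperbola ::
  "(real^2 \<Rightarrow> real) \<Rightarrow> (real^2) set \<Rightarrow> real^2 \<Rightarrow> (real^2) set" where
  "leading_circle_hyperbola N L x =
     {z. \<exists>\<epsilon>>0. disks_touch (disk N z \<epsilon>) L \<and> x \<in> frontier (disk N z \<epsilon>)}"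

definition leading_line_hyperbola ::
  "(real^2 \<Rightarrow> real) \<Rightarrow> (real^2) set \<Rightarrow> real^2 \<Rightarrow> real \<Rightarrow> (real^2) set" where
  "leading_line_hyperbola N l x \<gamma> =
     {z. \<exists>\<epsilon>>0. x \<in> frontier (disk N z \<epsilon>) \<and> disk_touches_line (disk N z (\<gamma> * \<epsilon>)) l}"

end

theory Submission
  imports Defs
begin

text \<open>
  The circle of radius \<open>\<epsilon>\<close> about \<open>z\<close> touches the circle of radius \<open>2b\<close> about \<open>c\<close> exactly when the
  distance of the centres is \<open>\<epsilon> + 2b\<close> or \<open>\<bar>\<epsilon> - 2b\<bar>\<close>. If \<open>x\<close> is exterior to the leading circle and
  \<open>\<epsilon> = N (z - x)\<close>, the triangle inequality rules out \<open>2b - \<epsilon>\<close>, and what remains says that \<open>z\<close> lies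
  on the hyperbola with foci \<open>x\<close>, \<open>c\<close>.

  The maximum norm separates the third class from the other two, in both directions. A hyperbola
  with two foci is centrally symmetric, but the leading line \<open>z$2 = 0\<close> with focus \<open>(0,1)\<close> and ratio
  \<open>1/2\<close> yields a curve without centre. Conversely, the foci \<open>(-1,-1)\<close>, \<open>(1,1)\<close> and \<open>2a = 1\<close> give the
  two parallel lines \<open>\<bar>z$1 + z$2\<bar> = 1\<close>. A curve with a leading line never meets that line, so the
  leading line would have to be parallel to these two; but then the distance to it is constant
  along each of them, whereas the distance to the focus is unbounded.
\<close>

section \<open>Elementary facts about a plane norm\<close>

context
  fixes N :: "real^2 \<Rightarrow> real"
  assumes N: "plane_norm N"
begin

lemma plane_norm_scale: "N (t *\<^sub>R x) = \<bar>t\<bar> * N x"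
  using N by (simp add: plane_norm_def)

lemma plane_norm_triangle: "N (x + y) \<le> N x + N y"
  using N by (simp add: plane_norm_def)

lemma plane_norm_eq_0: "N x = 0 \<longleftrightarrow> x = 0"
  using N by (simp add: plane_norm_def)

lemma plane_norm_minus: "N (- x) = N x"
  using plane_norm_scale[of "-1" x] by simp

lemma plane_norm_commute: "N (x - y) = N (y - x)"
  using plane_norm_minus[of "x - y"] by simp

lemma plane_norm_nonneg: "0 \<le> N x"
  using plane_norm_triangle[of x "- x"] plane_norm_eq_0[of 0] by (simp add: plane_norm_minus)

lemma plane_norm_triangle3: "N (x - z) \<le> N (x - y) + N (y - z)"
  using plane_norm_triangle[of "x - y" "y - z"] by simp

text \<open>Allowing \<open>x = 0\<close>, where any unit vector serves, lets the touching arguments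
  below treat coincident centres like all others.\<close>

lemma plane_norm_direction: "\<exists>u. N u = 1 \<and> x = N x *\<^sub>R u"
proof -
  obtain e :: "real^2" where e: "e \<noteq> 0" "x \<noteq> 0 \<Longrightarrow> e = x"
    using axis_eq_0_iff[of 1 "1::real"] by (metis zero_neq_one)
  have "N e \<noteq> 0"
    using e(1) by (simp add: plane_norm_eq_0)
  then have "N ((1 / N e) *\<^sub>R e) = 1"
    using plane_norm_nonneg[of e] by (simp add: plane_norm_scale)
  moreover have "x = N x *\<^sub>R ((1 / N e) *\<^sub>R e)"
    using e(2) \<open>N e \<noteq> 0\<close> plane_norm_eq_0 by (cases "x = 0") auto
  ultimately show ?thesis by blast
qed

text \<open>The triangle inequality and homogeneity make \<open>N\<close> convex, and convex
  functions on a finite-dimensional space are continuous. This links \<open>N\<close> to the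
  standard topology.\<close>

lemma continuous_on_plane_norm: "continuous_on UNIV N"
proof (rule convex_on_continuous)
  show "convex_on UNIV N"
  proof
    fix t :: real and x y :: "real^2"
    assume "0 < t" "t < 1"
    then show "N ((1 - t) *\<^sub>R x + t *\<^sub>R y) \<le> (1 - t) * N x + t * N y"
      using plane_norm_triangle[of "(1 - t) *\<^sub>R x" "t *\<^sub>R y"] by (simp add: plane_norm_scale)
  qed simp
qed simp

section \<open>Disks, their interiors and their boundaries\<close>

lemma disk_eq:
  assumes "0 < r"
  shows "disk N c r = {p. N (p - c) \<le> r}"
proof (intro set_eqI iffI)
  fix p assume "p \<in> disk N c r"
  then show "p \<in> {p. N (p - c) \<le> r}"
    using assms by (auto simp: disk_def unit_disk_def plane_norm_scale)
next
  fix p assume "p \<in> {p. N (p - c) \<le> r}"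
  then have "N ((1 / r) *\<^sub>R (p - c)) \<le> 1" "p = c + r *\<^sub>R ((1 / r) *\<^sub>R (p - c))"
    using assms by (simp_all add: plane_norm_scale)
  then show "p \<in> disk N c r"
    unfolding disk_def unit_disk_def by blast
qed

lemma mem_disk_iff: "0 < r \<Longrightarrow> p \<in> disk N c r \<longleftrightarrow> N (p - c) \<le> r"
  by (simp add: disk_eq)

lemma interior_disk:
  assumes "0 < r"
  shows "interior (disk N c r) = {p. N (p - c) < r}"
proof
  have "open {p. N (p - c) < r}"
    by (intro open_Collect_less continuous_intros
        continuous_on_compose2[OF continuous_on_plane_norm]) auto
  then show "{p. N (p - c) < r} \<subseteq> interior (disk N c r)"
    by (intro interior_maximal) (auto simp: disk_eq[OF assms])
  show "interior (disk N c r) \<subseteq> {p. N (p - c) < r}"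
  proof
    fix p assume p: "p \<in> interior (disk N c r)"
    \<comment> \<open>An interior point can be pushed a little away from \<open>c\<close> without
      leaving the disk. The push multiplies its distance from \<open>c\<close> by
      \<open>1 + t\<close>, so the original distance was already below \<open>r\<close>.\<close>
    have "((\<lambda>t. p + t *\<^sub>R (p - c)) \<longlongrightarrow> p + 0 *\<^sub>R (p - c)) (at_right 0)"
      by (intro tendsto_intros)
    then have "\<forall>\<^sub>F t in at_right 0. p + t *\<^sub>R (p - c) \<in> interior (disk N c r)"
      using p by (intro topological_tendstoD) auto
    moreover have "\<forall>\<^sub>F t in at_right (0::real). 0 < t"
      by (simp add: eventually_at_right_less)
    ultimately have "\<forall>\<^sub>F t in at_right 0. 0 < t \<and> p + t *\<^sub>R (p - c) \<in> interior (disk N c r)"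
      by eventually_elim simp
    from eventually_happens[OF this]
    obtain t where t: "0 < t" "p + t *\<^sub>R (p - c) \<in> interior (disk N c r)"
      by auto
    then have "N ((1 + t) *\<^sub>R (p - c)) \<le> r"
      using interior_subset[of "disk N c r"] by (auto simp: disk_eq[OF assms] algebra_simps)
    then have "(1 + t) * N (p - c) \<le> r"
      using t(1) by (simp add: plane_norm_scale)
    moreover have "N (p - c) < (1 + t) * N (p - c) \<or> N (p - c) = 0"
      using t(1) plane_norm_nonneg[of "p - c"] by (auto simp: algebra_simps)
    ultimately show "p \<in> {p. N (p - c) < r}"
      using assms by auto
  qed
qed

lemma frontier_disk:
  assumes "0 < r"
  shows "frontier (disk N c r) = {p. N (p - c) = r}"
proof -
  have "closed (disk N c r)"
    unfolding disk_eq[OF assms]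
    by (intro closed_Collect_le continuous_intros
        continuous_on_compose2[OF continuous_on_plane_norm]) auto
  then have "frontier (disk N c r) = disk N c r - {p. N (p - c) < r}"
    by (simp add: frontier_def interior_disk[OF assms])
  then show ?thesis
    by (auto simp: disk_eq[OF assms])
qed

section \<open>Touching disks in terms of the distance of their centres\<close>

lemma disks_touch_commute: "disks_touch D E \<longleftrightarrow> disks_touch E D"
  by (auto simp: disks_touch_def)

text \<open>The common boundary point lies on the ray from \<open>z\<close> through
  \<open>c\<close>, at distance \<open>r\<close> from \<open>z\<close>. If \<open>r = s\<close>, the
  disks coincide and any direction \<open>u\<close> works.\<close>

lemma disks_touch_inside:
  assumes "0 < r" "0 < s" "N (z - c) = r - s"
  shows "disks_touch (disk N z r) (disk N c s)"
proof -
  obtain u where u: "N u = 1" "c - z = N (c - z) *\<^sub>R u"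
    using plane_norm_direction by blast
  then have cz: "c = z + (r - s) *\<^sub>R u"
    using assms(3) by (metis add.commute diff_add_cancel plane_norm_commute)
  have "z + r *\<^sub>R u - c = s *\<^sub>R u"
    by (simp add: cz algebra_simps)
  then have "z + r *\<^sub>R u \<in> frontier (disk N z r) \<inter> frontier (disk N c s)"
    using assms(1,2) u(1) by (simp add: frontier_disk plane_norm_scale)
  moreover have "disk N c s \<subseteq> disk N z r"
  proof
    fix p assume "p \<in> disk N c s"
    then show "p \<in> disk N z r"
      using assms plane_norm_triangle3[of p z c]
      by (simp add: disk_eq plane_norm_commute[of c z])
  qed
  ultimately show ?thesis
    by (auto simp: disks_touch_def)
qed

text \<open>The common boundary point is the point of the segment from \<open>c\<close> to
  \<open>z\<close> at distance \<open>s\<close> from \<open>c\<close>; a point in both interiors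
  would violate the triangle inequality.\<close>

lemma disks_touch_outside:
  assumes "0 < r" "0 < s" "N (z - c) = r + s"
  shows "disks_touch (disk N z r) (disk N c s)"
proof -
  obtain u where u: "N u = 1" "z - c = N (z - c) *\<^sub>R u"
    using plane_norm_direction by blast
  then have zc: "z = c + (r + s) *\<^sub>R u"
    using assms(3) by (metis add.commute diff_add_cancel)
  have "c + s *\<^sub>R u - z = (- r) *\<^sub>R u"
    by (simp add: zc algebra_simps)
  then have "N (c + s *\<^sub>R u - z) = r"
    using assms(1) u(1) by (simp only: plane_norm_scale)
  then have "c + s *\<^sub>R u \<in> frontier (disk N z r) \<inter> frontier (disk N c s)"
    using assms(1,2) u(1) by (simp add: frontier_disk plane_norm_scale)
  moreover have "interior (disk N z r) \<inter> interior (disk N c s) = {}"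
  proof -
    have False if "N (p - z) < r" "N (p - c) < s" for p
      using that assms(3) plane_norm_triangle3[of z c p] plane_norm_commute[of p z] by simp
    then show ?thesis
      using assms(1,2) by (auto simp: interior_disk)
  qed
  ultimately show ?thesis
    by (auto simp: disks_touch_def)
qed

text \<open>Test the inclusion on a point of the inner disk farthest from \<open>c\<close>: go from
  \<open>z\<close> a further \<open>r\<close> in the direction away from \<open>c\<close>.\<close>

lemma disk_subset_imp:
  assumes "0 < r" "0 < s" "disk N z r \<subseteq> disk N c s"
  shows "N (z - c) + r \<le> s"
proof -
  obtain u where u: "N u = 1" "z - c = N (z - c) *\<^sub>R u"
    using plane_norm_direction by blast
  have "z + r *\<^sub>R u \<in> disk N z r"
    using assms(1) u(1) by (simp add: disk_eq plane_norm_scale)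
  then have "N (z + r *\<^sub>R u - c) \<le> s"
    using assms(2,3) by (auto simp: disk_eq)
  moreover have "z + r *\<^sub>R u - c = (N (z - c) + r) *\<^sub>R u"
    using u(2) by (metis scaleR_add_left add_diff_eq diff_add_eq)
  ultimately show ?thesis
    using u(1) assms(1) plane_norm_nonneg[of "z - c"] by (simp add: plane_norm_scale)
qed

lemma interior_disks_disjoint_imp:
  assumes "0 < r" "0 < s" "interior (disk N z r) \<inter> interior (disk N c s) = {}"
  shows "r + s \<le> N (z - c)"
proof (rule ccontr)
  assume "\<not> ?thesis"
  then have d: "N (z - c) / (r + s) < 1"
    using assms(1,2) by simp
  \<comment> \<open>\<open>p\<close> divides the segment from \<open>c\<close> to \<open>z\<close>
    in the ratio \<open>s : r\<close>; if the centres are closer than \<open>r + s\<close>, it lies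
    in both interiors.\<close>
  define p where "p = c + (s / (r + s)) *\<^sub>R (z - c)"
  have "p - z = (s / (r + s) - 1) *\<^sub>R (z - c)"
    by (simp add: p_def algebra_simps)
  also have "s / (r + s) - 1 = - (r / (r + s))"
    using assms(1,2) by (simp add: field_simps)
  finally have "N (p - z) = r * (N (z - c) / (r + s))"
    using assms(1,2) by (simp only: plane_norm_scale) simp
  then have "N (p - z) < r"
    using mult_strict_left_mono[OF d assms(1)] by simp
  moreover have "N (p - c) = s * (N (z - c) / (r + s))"
    using assms(1,2) by (simp add: p_def plane_norm_scale)
  then have "N (p - c) < s"
    using mult_strict_left_mono[OF d assms(2)] by simp
  ultimately show False
    using assms by (auto simp: interior_disk)
qed

text \<open>A common boundary point confines the distance of the centres to the interval from
  \<open>\<bar>r - s\<bar>\<close> to \<open>r + s\<close>. Disjoint interiors force the upper end,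
  an inclusion the lower end.\<close>

lemma disks_touch_iff:
  assumes "0 < r" "0 < s"
  shows "disks_touch (disk N z r) (disk N c s) \<longleftrightarrow> N (z - c) = r + s \<or> N (z - c) = \<bar>r - s\<bar>"
proof
  assume touch: "disks_touch (disk N z r) (disk N c s)"
  then obtain p where "N (p - z) = r" "N (p - c) = s"
    using assms by (auto simp: disks_touch_def frontier_disk)
  then have bounds: "N (z - c) \<le> r + s" "\<bar>r - s\<bar> \<le> N (z - c)"
    using plane_norm_triangle3[of z c p] plane_norm_triangle3[of p z c]
      plane_norm_triangle3[of p c z] plane_norm_commute[of p z] plane_norm_commute[of z c]
    by auto
  from touch consider "interior (disk N z r) \<inter> interior (disk N c s) = {}"
    | "disk N z r \<subseteq> disk N c s" | "disk N c s \<subseteq> disk N z r"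
    unfolding disks_touch_def by blast
  then show "N (z - c) = r + s \<or> N (z - c) = \<bar>r - s\<bar>"
  proof cases
    case 1
    then show ?thesis
      using interior_disks_disjoint_imp[OF assms] bounds by fastforce
  next
    case 2
    then show ?thesis
      using disk_subset_imp[OF assms] bounds by fastforce
  next
    case 3
    then show ?thesis
      using disk_subset_imp[OF assms(2,1)] bounds plane_norm_commute[of z c] by fastforce
  qed
next
  assume "N (z - c) = r + s \<or> N (z - c) = \<bar>r - s\<bar>"
  then consider "N (z - c) = r + s" | "N (z - c) = r - s" | "N (c - z) = s - r"
    using plane_norm_commute[of z c] by linarith
  then show "disks_touch (disk N z r) (disk N c s)"
    using assms disks_touch_outside disks_touch_inside disks_touch_commute by cases blast+
qed

section \<open>Leading circle versus foci: the centre of the circle is the second focus\<close>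

lemma leading_circle_hyperbola_eq_foci_hyperbola:
  assumes "0 < b" "2 * b < N (x - c)"
  shows "leading_circle_hyperbola N (disk N c (2 * b)) x = foci_hyperbola N x c b"
proof (intro set_eqI iffI)
  fix z assume "z \<in> leading_circle_hyperbola N (disk N c (2 * b)) x"
  then obtain \<epsilon> where "0 < \<epsilon>" "N (z - c) = \<epsilon> + 2 * b \<or> N (z - c) = \<bar>\<epsilon> - 2 * b\<bar>" "N (x - z) = \<epsilon>"
    using assms(1) by (auto simp: leading_circle_hyperbola_def disks_touch_iff frontier_disk)
  then show "z \<in> foci_hyperbola N x c b"
    using assms plane_norm_triangle3[of x c z] plane_norm_commute[of x z] plane_norm_commute[of z c]
    by (auto simp: foci_hyperbola_def)
next
  fix z assume "z \<in> foci_hyperbola N x c b"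
  then have z: "\<bar>N (x - z) - N (z - c)\<bar> = 2 * b"
    by (simp add: foci_hyperbola_def plane_norm_commute[of z x] plane_norm_commute[of c z])
  \<comment> \<open>For \<open>z = x\<close> the equation would read
    \<open>N (x - c) = 2 * b\<close>, against exteriority; hence the radius \<open>N (x - z)\<close>
    is positive.\<close>
  have "z \<noteq> x"
    using z assms plane_norm_eq_0[of 0] by auto
  then have "0 < N (x - z)"
    using plane_norm_nonneg[of "x - z"] plane_norm_eq_0[of "x - z"] by force
  moreover have "N (z - c) = N (x - z) + 2 * b \<or> N (z - c) = \<bar>N (x - z) - 2 * b\<bar>"
    using z assms(1) plane_norm_nonneg[of "z - c"] by linarith
  then have "disks_touch (disk N z (N (x - z))) (disk N c (2 * b))"
    using \<open>0 < N (x - z)\<close> assms(1) by (simp add: disks_touch_iff)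
  ultimately show "z \<in> leading_circle_hyperbola N (disk N c (2 * b)) x"
    by (auto simp: leading_circle_hyperbola_def frontier_disk)
qed

section \<open>Features of the two kinds of curves, in an arbitrary norm, that tell them
  apart\<close>

lemma foci_hyperbola_central_symmetry:
  assumes "z \<in> foci_hyperbola N x y a"
  shows "x + y - z \<in> foci_hyperbola N x y a"
  using assms plane_norm_commute[of z x] plane_norm_commute[of y z]
  by (simp add: foci_hyperbola_def)

text \<open>This extracts the half of the touching condition used to exclude points: the interior of
  the small disk misses \<open>l\<close>, so each point of \<open>l\<close> bounds the focal
  distance of \<open>z\<close> from above.\<close>

lemma leading_line_hyperbola_focal_distance:
  assumes "0 < \<gamma>" "z \<in> leading_line_hyperbola N l x \<gamma>" "u \<in> l"
  shows "0 < N (x - z) \<and> \<gamma> * N (x - z) \<le> N (u - z)"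
proof -
  obtain \<epsilon> where \<epsilon>: "0 < \<epsilon>" "N (x - z) = \<epsilon>" "interior (disk N z (\<gamma> * \<epsilon>)) \<inter> l = {}"
    using assms(2) by (auto simp: leading_line_hyperbola_def disk_touches_line_def frontier_disk)
  have "u \<notin> interior (disk N z (\<gamma> * \<epsilon>))"
    using \<epsilon>(3) assms(3) by blast
  then show ?thesis
    using \<epsilon>(1,2) assms(1) by (simp add: interior_disk not_less)
qed

lemma leading_line_hyperbola_disjoint_line:
  assumes "0 < \<gamma>"
  shows "leading_line_hyperbola N l x \<gamma> \<inter> l = {}"
proof -
  have False if "z \<in> leading_line_hyperbola N l x \<gamma>" "z \<in> l" for z
    using leading_line_hyperbola_focal_distance[OF assms that] assms plane_norm_eq_0[of 0]
    by (auto simp: mult_le_0_iff)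
  then show ?thesis by blast
qed

lemma leading_line_hyperbola_contains_no_parallel:
  assumes "0 < \<gamma>" "v \<noteq> 0" "range (\<lambda>t. u + t *\<^sub>R v) \<subseteq> l"
  shows "\<not> range (\<lambda>t. w + t *\<^sub>R v) \<subseteq> leading_line_hyperbola N l x \<gamma>"
proof
  assume sub: "range (\<lambda>t. w + t *\<^sub>R v) \<subseteq> leading_line_hyperbola N l x \<gamma>"
  have "0 < N v"
    using assms(2) plane_norm_nonneg[of v] plane_norm_eq_0[of v] by force
  \<comment> \<open>Compare \<open>w + t *\<^sub>R v\<close> with the point
    \<open>u + t *\<^sub>R v\<close> of \<open>l\<close>: their distance does not depend on
    \<open>t\<close>, while the focal distance grows at least like
    \<open>\<bar>t\<bar> * N v\<close>.\<close>
  have bound: "\<gamma> * (\<bar>t\<bar> * N v - N (x - w)) \<le> N (u - w)" for t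
  proof -
    have "\<gamma> * N (x - (w + t *\<^sub>R v)) \<le> N (u + t *\<^sub>R v - (w + t *\<^sub>R v))"
      using leading_line_hyperbola_focal_distance[OF assms(1)] sub assms(3) by blast
    moreover have "N (w + t *\<^sub>R v - w) \<le> N (w + t *\<^sub>R v - x) + N (x - w)"
      by (rule plane_norm_triangle3)
    then have "\<bar>t\<bar> * N v - N (x - w) \<le> N (x - (w + t *\<^sub>R v))"
      by (simp add: plane_norm_scale plane_norm_commute[of x])
    then have "\<gamma> * (\<bar>t\<bar> * N v - N (x - w)) \<le> \<gamma> * N (x - (w + t *\<^sub>R v))"
      using assms(1) by (simp add: mult_left_mono)
    ultimately show ?thesis by simp
  qed
  \<comment> \<open>Solves for the value at which the left side of \<open>bound\<close> exceeds the
    right side by \<open>\<gamma>\<close>.\<close>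
  define t where "t = (N (x - w) + N (u - w) / \<gamma> + 1) / N v"
  have "0 \<le> t"
    using assms(1) \<open>0 < N v\<close> by (simp add: t_def plane_norm_nonneg)
  then have "\<gamma> * (\<bar>t\<bar> * N v - N (x - w)) = N (u - w) + \<gamma>"
    using assms(1) \<open>0 < N v\<close> by (simp add: t_def field_simps)
  then show False
    using bound[of t] assms(1) by linarith
qed

end

section \<open>Straight lines in coordinates\<close>

lemma straight_line_parametrised:
  assumes "straight_line l"
  shows "\<exists>u v. v \<noteq> 0 \<and> range (\<lambda>t. u + t *\<^sub>R v) \<subseteq> l"
proof -
  have l: "affine l" "aff_dim l = 1"
    using assms by (auto simp: straight_line_def)
  have "l \<noteq> {}"
    using l(2) by auto
  then obtain p where p: "p \<in> l" by blast
  have "l \<noteq> {p}"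
    using l(2) by auto
  then obtain q where q: "q \<in> l" "q \<noteq> p"
    using p by blast
  have "affine hull {p, q} \<subseteq> l"
    using p q(1) l(1) by (intro hull_minimal) auto
  then show ?thesis
    using q(2) unfolding affine_hull_2_alt by (metis right_minus_eq)
qed

lemma straight_line_horizontal: "straight_line {z. z $ 2 = 0}"
proof -
  have "{z::real^2. z $ 2 = 0} = affine hull {0, axis 1 1}"
  proof (intro set_eqI iffI)
    fix z :: "real^2" assume "z \<in> {z. z $ 2 = 0}"
    then have "z = 0 + (z $ 1) *\<^sub>R (axis 1 1 - 0)"
      by (simp add: vec_eq_iff forall_2 axis_def)
    then show "z \<in> affine hull {0, axis 1 1}"
      unfolding affine_hull_2_alt by blast
  next
    fix z :: "real^2" assume "z \<in> affine hull {0, axis 1 1}"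
    then show "z \<in> {z. z $ 2 = 0}"
      unfolding affine_hull_2_alt by (auto simp: axis_def)
  qed
  moreover have "(0::real^2) \<noteq> axis 1 1"
    by (simp add: axis_eq_0_iff eq_commute[of 0])
  ultimately show ?thesis
    by (simp add: straight_line_def affine_affine_hull)
qed

section \<open>The two counterexamples in the maximum norm\<close>

lemma plane_norm_infnorm: "plane_norm infnorm"
  by (simp add: plane_norm_def infnorm_eq_0 infnorm_mul infnorm_triangle)

lemma disk_infnorm_touches_horizontal_iff:
  assumes "0 < r"
  shows "disk_touches_line (disk infnorm z r) {p. p $ 2 = 0} \<longleftrightarrow> \<bar>z $ 2\<bar> = r"
proof -
  have dist: "\<bar>z $ 2\<bar> \<le> infnorm (p - z)" if "p $ 2 = 0" for p :: "real^2"
    using that by (simp add: infnorm_2)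
  \<comment> \<open>The vertical projection of \<open>z\<close> to the line is a nearest point of
    the line in the maximum norm.\<close>
  define q :: "real^2" where "q = vector [z $ 1, 0]"
  have q: "q $ 2 = 0" "infnorm (q - z) = \<bar>z $ 2\<bar>"
    by (simp_all add: q_def infnorm_2)
  show ?thesis
    unfolding disk_touches_line_def interior_disk[OF plane_norm_infnorm assms]
    unfolding disk_eq[OF plane_norm_infnorm assms]
  proof
    assume "{p. infnorm (p - z) \<le> r} \<inter> {p. p $ 2 = 0} \<noteq> {} \<and>
      {p. infnorm (p - z) < r} \<inter> {p. p $ 2 = 0} = {}"
    then obtain p where "infnorm (p - z) \<le> r" "p $ 2 = 0" "\<not> infnorm (q - z) < r"
      using q(1) by blast
    then show "\<bar>z $ 2\<bar> = r"
      using dist[of p] q(2) by simp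
  next
    assume "\<bar>z $ 2\<bar> = r"
    then have "q \<in> {p. infnorm (p - z) \<le> r} \<inter> {p. p $ 2 = 0}"
      "\<not> (infnorm (p - z) < r \<and> p $ 2 = 0)" for p
      using dist[of p] q by auto
    then show "{p. infnorm (p - z) \<le> r} \<inter> {p. p $ 2 = 0} \<noteq> {} \<and>
      {p. infnorm (p - z) < r} \<inter> {p. p $ 2 = 0} = {}"
      by blast
  qed
qed

lemma leading_line_hyperbola_infnorm:
  "leading_line_hyperbola infnorm {p. p $ 2 = 0} (vector [0, 1]) (1 / 2) =
    {z. 2 * \<bar>z $ 2\<bar> = max \<bar>z $ 1\<bar> \<bar>z $ 2 - 1\<bar>}"
proof -
  have "z \<in> leading_line_hyperbola infnorm {p. p $ 2 = 0} (vector [0, 1]) (1 / 2) \<longleftrightarrow>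
      (\<exists>\<epsilon>>0. max \<bar>z $ 1\<bar> \<bar>z $ 2 - 1\<bar> = \<epsilon> \<and> \<bar>z $ 2\<bar> = \<epsilon> / 2)" for z
    by (auto simp: leading_line_hyperbola_def frontier_disk[OF plane_norm_infnorm]
        disk_infnorm_touches_horizontal_iff infnorm_2 abs_minus_commute)
  \<comment> \<open>This supplies the positive radius: a zero maximum means
    \<open>z = (0,1)\<close>, where the left side of the equation is 2.\<close>
  moreover have "0 < max \<bar>z $ 1\<bar> \<bar>z $ 2 - 1\<bar>" if "2 * \<bar>z $ 2\<bar> = max \<bar>z $ 1\<bar> \<bar>z $ 2 - 1\<bar>"
    for z :: "real^2"
    using that by (auto simp: max_def split: if_splits)
  ultimately show ?thesis by auto
qed

text \<open>The curve contains (2t, t) and (-2t, t) for all t \<ge> 1. Reflecting both in the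
  midpoint of the foci, for large t, forces that midpoint to be the origin, and the curve is not
  symmetric about the origin.\<close>

lemma leading_line_hyperbola_infnorm_not_foci:
  "leading_line_hyperbola infnorm {p. p $ 2 = 0} (vector [0, 1]) (1 / 2) \<noteq>
    foci_hyperbola infnorm x y a"
proof
  let ?S = "leading_line_hyperbola infnorm {p. p $ 2 = 0} (vector [0, 1]) (1 / 2)"
  assume "?S = foci_hyperbola infnorm x y a"
  then have S: "z \<in> ?S \<Longrightarrow> x + y - z \<in> ?S" for z
    using foci_hyperbola_central_symmetry[OF plane_norm_infnorm] by blast
  then have sym: "2 * \<bar>q - t\<bar> = max \<bar>p - s\<bar> \<bar>q - t - 1\<bar>"
    if "2 * \<bar>t\<bar> = max \<bar>s\<bar> \<bar>t - 1\<bar>" "p = x $ 1 + y $ 1" "q = x $ 2 + y $ 2" for p q s t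
    using that S[of "vector [s, t]"] by (simp add: leading_line_hyperbola_infnorm)
  define p q where pq: "p = x $ 1 + y $ 1" "q = x $ 2 + y $ 2"
  \<comment> \<open>So large that at both reflected points the first coordinate attains the maximum
    and all absolute values resolve with known signs.\<close>
  define t where "t = \<bar>p\<bar> + 2 * \<bar>q\<bar> + 2"
  have t: "1 \<le> t" "\<bar>p\<bar> \<le> t" "\<bar>q\<bar> \<le> t" "q < t - 1"
    unfolding t_def by linarith+
  have "2 * \<bar>t\<bar> = max \<bar>2 * t\<bar> \<bar>t - 1\<bar>" "2 * \<bar>t\<bar> = max \<bar>- 2 * t\<bar> \<bar>t - 1\<bar>"
    using t(1) by simp_all
  then have "2 * \<bar>q - t\<bar> = max \<bar>p - 2 * t\<bar> \<bar>q - t - 1\<bar>"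
    "2 * \<bar>q - t\<bar> = max \<bar>p - - 2 * t\<bar> \<bar>q - t - 1\<bar>"
    using sym pq by blast+
  moreover have "\<bar>q - t - 1\<bar> < 2 * \<bar>q - t\<bar>"
    using t(4) by (simp add: abs_if)
  ultimately have "2 * \<bar>q - t\<bar> = \<bar>p - 2 * t\<bar>" "2 * \<bar>q - t\<bar> = \<bar>p - - 2 * t\<bar>"
    by (metis less_irrefl max_def)+
  moreover have "\<bar>q - t\<bar> = t - q" "\<bar>p - 2 * t\<bar> = 2 * t - p" "\<bar>p - - 2 * t\<bar> = 2 * t + p"
    using t by linarith+
  ultimately have "2 * (t - q) = 2 * t - p" "2 * (t - q) = 2 * t + p"
    by simp_all
  then have "p = 0" "q = 0"
    by simp_all
  \<comment> \<open>The point (0, 1/3) is on the curve, but (0, -1/3) is not: there 2/3 would have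
    to equal 4/3.\<close>
  then show False
    using sym[of "1 / 3" 0 p q] pq by simp
qed

text \<open>The difference of the two focal distances is the coordinate sum truncated to the
  interval from -2 to 2, so its levels 1 and -1 are full lines.\<close>

lemma foci_hyperbola_infnorm_diagonal:
  "foci_hyperbola infnorm (vector [- 1, - 1]) (vector [1, 1]) (1 / 2) = {z. \<bar>z $ 1 + z $ 2\<bar> = 1}"
proof -
  have "\<bar>max \<bar>s + 1\<bar> \<bar>t + 1\<bar> - max \<bar>1 - s\<bar> \<bar>1 - t\<bar>\<bar> = 1 \<longleftrightarrow> \<bar>s + t\<bar> = 1" for s t :: real
    by (simp add: max_def abs_if) linarith
  then show ?thesis
    by (simp add: foci_hyperbola_def infnorm_2)
qed

lemma diagonal_not_leading_line_hyperbola: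
  assumes "plane_norm N" "straight_line l" "0 < \<gamma>"
  shows "{z. \<bar>z $ 1 + z $ 2\<bar> = 1} \<noteq> leading_line_hyperbola N l x \<gamma>"
proof
  assume eq: "{z. \<bar>z $ 1 + z $ 2\<bar> = 1} = leading_line_hyperbola N l x \<gamma>"
  obtain u v where uv: "v \<noteq> 0" "range (\<lambda>t. u + t *\<^sub>R v) \<subseteq> l"
    using straight_line_parametrised[OF assms(2)] by blast
  show False
  proof (cases "v $ 1 + v $ 2 = 0")
    case True
    \<comment> \<open>Here \<open>l\<close> is parallel to the two lines, and
      \<open>axis 1 1\<close> lies on one of them.\<close>
    then have "(axis 1 1 + t *\<^sub>R v) $ 1 + (axis 1 1 + t *\<^sub>R v) $ 2 = 1" for t
      by (simp add: axis_def flip: distrib_left)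
    then have "range (\<lambda>t. axis 1 1 + t *\<^sub>R v) \<subseteq> {z. \<bar>z $ 1 + z $ 2\<bar> = 1}"
      by auto
    then show False
      using leading_line_hyperbola_contains_no_parallel[OF assms(1,3) uv] eq by blast
  next
    case False
    \<comment> \<open>The parameter at which \<open>l\<close> crosses the line of coordinate sum 1,
      giving a common point of \<open>l\<close> and the curve.\<close>
    define t where "t = (1 - u $ 1 - u $ 2) / (v $ 1 + v $ 2)"
    have "t * (v $ 1 + v $ 2) = 1 - u $ 1 - u $ 2"
      using False by (simp add: t_def)
    then have "u + t *\<^sub>R v \<in> {z. \<bar>z $ 1 + z $ 2\<bar> = 1}"
      by (simp add: algebra_simps)
    then show False
      using leading_line_hyperbola_disjoint_line[OF assms(1,3)] eq uv(2) by blast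
  qed
qed

theorem proposition2:
  "(\<forall>N. plane_norm N \<longrightarrow>
      (\<forall>x y a. 0 < a \<and> 2 * a < N (x - y) \<longrightarrow>
         (\<exists>c b. 0 < b \<and> x \<notin> disk N c (2 * b) \<and>
            foci_hyperbola N x y a = leading_circle_hyperbola N (disk N c (2 * b)) x))) \<and>
   (\<forall>N. plane_norm N \<longrightarrow>
      (\<forall>c b x. 0 < b \<and> x \<notin> disk N c (2 * b) \<longrightarrow>
         (\<exists>y a. 0 < a \<and> 2 * a < N (x - y) \<and>
            leading_circle_hyperbola N (disk N c (2 * b)) x = foci_hyperbola N x y a))) \<and>
   (\<exists>N. plane_norm N \<and>
      (\<exists>l x \<gamma>. straight_line l \<and> x \<notin> l \<and> 0 < \<gamma> \<and> \<gamma> < 1 \<and>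
         (\<forall>x' y' a. 0 < a \<longrightarrow>
            leading_line_hyperbola N l x \<gamma> \<noteq> foci_hyperbola N x' y' a)) \<and>
      (\<exists>x y a. 0 < a \<and> 2 * a < N (x - y) \<and>
         (\<forall>l x' \<gamma>. straight_line l \<and> 0 < \<gamma> \<and> \<gamma> < 1 \<longrightarrow>
            foci_hyperbola N x y a \<noteq> leading_line_hyperbola N l x' \<gamma>)))"
proof (intro conjI allI impI)
  fix N :: "real^2 \<Rightarrow> real" and x y a
  assume "plane_norm N" "0 < a \<and> 2 * a < N (x - y)"
  then show "\<exists>c b. 0 < b \<and> x \<notin> disk N c (2 * b) \<and>
      foci_hyperbola N x y a = leading_circle_hyperbola N (disk N c (2 * b)) x"
    by (intro exI[of _ y] exI[of _ a])
      (simp add: mem_disk_iff leading_circle_hyperbola_eq_foci_hyperbola)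
next
  fix N :: "real^2 \<Rightarrow> real" and c b x
  assume "plane_norm N" "0 < b \<and> x \<notin> disk N c (2 * b)"
  then have "plane_norm N" "0 < b" "2 * b < N (x - c)"
    by (auto simp: mem_disk_iff)
  then show "\<exists>y a. 0 < a \<and> 2 * a < N (x - y) \<and>
      leading_circle_hyperbola N (disk N c (2 * b)) x = foci_hyperbola N x y a"
    using leading_circle_hyperbola_eq_foci_hyperbola by blast
next
  have "\<exists>l x \<gamma>. straight_line l \<and> x \<notin> l \<and> 0 < \<gamma> \<and> \<gamma> < 1 \<and>
      (\<forall>x' y' a. 0 < a \<longrightarrow>
        leading_line_hyperbola infnorm l x \<gamma> \<noteq> foci_hyperbola infnorm x' y' a)"
    using straight_line_horizontal leading_line_hyperbola_infnorm_not_foci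
    by (intro exI[of _ "{p. p $ 2 = 0}"] exI[of _ "vector [0, 1]"] exI[of _ "1 / 2"]) simp
  moreover have "\<exists>x y a. 0 < a \<and> 2 * a < infnorm (x - y) \<and>
      (\<forall>l x' \<gamma>. straight_line l \<and> 0 < \<gamma> \<and> \<gamma> < 1 \<longrightarrow>
        foci_hyperbola infnorm x y a \<noteq> leading_line_hyperbola infnorm l x' \<gamma>)"
    \<comment> \<open>The foci are at distance 2 in the maximum norm, which exceeds
      \<open>2 * a = 1\<close>.\<close>
    using diagonal_not_leading_line_hyperbola[OF plane_norm_infnorm]
    by (intro exI[of _ "vector [- 1, - 1]"] exI[of _ "vector [1, 1]"] exI[of _ "1 / 2"])
      (simp add: foci_hyperbola_infnorm_diagonal infnorm_2)
  ultimately show "\<exists>N. plane_norm N \<and>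
      (\<exists>l x \<gamma>. straight_line l \<and> x \<notin> l \<and> 0 < \<gamma> \<and> \<gamma> < 1 \<and>
         (\<forall>x' y' a. 0 < a \<longrightarrow>
            leading_line_hyperbola N l x \<gamma> \<noteq> foci_hyperbola N x' y' a)) \<and>
      (\<exists>x y a. 0 < a \<and> 2 * a < N (x - y) \<and>
         (\<forall>l x' \<gamma>. straight_line l \<and> 0 < \<gamma> \<and> \<gamma> < 1 \<longrightarrow>
            foci_hyperbola N x y a \<noteq> leading_line_hyperbola N l x' \<gamma>))"
    using plane_norm_infnorm by blast
qed

end
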